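(* Let $F$ be a finite field, let $n>1$ be an integer, let $1\le k_1<\cdots<k_r\le n$ be integers with $1\le r\le n-1$, and let $S=\bigsqcup_{i=1}^r V_{k_i}\subset M_n(F)$. Then the gcd-graph $\Gamma(M_n(F),S)$ is not bipartite.
   Context: For $1\le k\le n$, $V_k$ denotes the set of all matrices of rank $k$ in the ring $M_n(F)$ of $n\times n$ matrices over $F$. $\Gamma(M_n(F),S)$ denotes the graph with vertex set $M_n(F)$ in which two vertices $X,Y$ are adjacent if $X-Y\in S$. It is called a gcd-graph when $GL_n(F)\,S\,GL_n(F)=S$; the gcd-graphs over $M_n(F)$ are those with $S$ a union of sets $V_k$, $1\le k\le n$, and the assumption $1\le r\le n-1$ excludes the empty and complete graphs. *)

theory Defs
  imports "Graph_Theory.Pair_Digraph" "Jordan_Normal_Form.DL_Rank"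
begin

definition rank_stratum :: "nat \<Rightarrow> nat \<Rightarrow> 'a::field mat set" where
  "rank_stratum n k = {X \<in> carrier_mat n n. vec_space.rank n X = k}"

text \<open>As usual for \<^locale>\<open>pair_graph\<close>, an undirected edge between \<open>X\<close> and \<open>Y\<close> is
  represented by the two arcs \<open>(X, Y)\<close> and \<open>(Y, X)\<close>.\<close>

definition matrix_cayley_graph :: "nat \<Rightarrow> 'a::field mat set \<Rightarrow> 'a mat pair_pre_digraph" where
  "matrix_cayley_graph n S =
     \<lparr> pverts = carrier_mat n n,
       parcs = {(X, Y). X \<in> carrier_mat n n \<and> Y \<in> carrier_mat n n \<and> X - Y \<in> S} \<rparr>"

definition bipartite :: "('v, 'e) pre_digraph \<Rightarrow> bool" where
  "bipartite G \<longleftrightarrow>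
     (\<exists>U W. verts G = U \<union> W \<and> U \<inter> W = {} \<and>
        (\<forall>e \<in> arcs G. (tail G e \<in> U \<and> head G e \<in> W) \<or> (tail G e \<in> W \<and> head G e \<in> U)))"

definition GL :: "nat \<Rightarrow> 'a::field mat set" where
  "GL n = {P \<in> carrier_mat n n. invertible_mat P}"

definition gcd_connection_set :: "nat \<Rightarrow> 'a::field mat set \<Rightarrow> bool" where
  "gcd_connection_set n S \<longleftrightarrow> {P * X * Q | P X Q. P \<in> GL n \<and> X \<in> S \<and> Q \<in> GL n} = S"

text \<open>The remaining facts confirm that a union \<open>S\<close> of sets of matrices of fixed positive rank
  satisfies \<open>GL S GL = S\<close> and yields a finite simple graph.\<close>

lemma GL_inverse:
  assumes "P \<in> GL n"
  obtains P' where "P' \<in> GL n" "P' * P = 1\<^sub>m n" "P * P' = 1\<^sub>m n"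
proof -
  have P: "P \<in> carrier_mat n n" and "invertible_mat P"
    using assms by (auto simp: GL_def)
  then obtain P' where inv: "inverts_mat P P'" "inverts_mat P' P"
    unfolding invertible_mat_def by blast
  have P': "P' \<in> carrier_mat n n"
    using inv P unfolding inverts_mat_def
    by (metis carrier_matD(1) carrier_matD(2) carrier_mat_triv index_mult_mat(3) index_one_mat(3))
  have "invertible_mat P'"
    using inv P' unfolding invertible_mat_def by (auto simp: square_mat.simps)
  then show ?thesis
    using that[of P'] inv P P' by (auto simp: GL_def inverts_mat_def)
qed

lemma one_mat_in_GL: "1\<^sub>m n \<in> GL n"
  by (auto simp: GL_def invertible_mat_def inverts_mat_def intro!: exI[of _ "1\<^sub>m n"])

context vec_space
begin

lemma rank_mult_right:
  assumes X: "X \<in> carrier_mat n n" and Q: "Q \<in> GL n"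
  shows "rank (X * Q) \<le> rank X"
proof -
  have Q': "Q \<in> carrier_mat n n" using Q by (simp add: GL_def)
  have XQ: "X * Q \<in> carrier_mat n n" using X Q' by simp
  have sub: "col_space (X * Q) \<subseteq> col_space X"
    unfolding col_space_eq[OF XQ] col_space_eq[OF X]
    using X Q' by (auto simp: assoc_mult_mat_vec[OF X Q'] intro!: bexI[of _ "Q *\<^sub>v _"])
  have s1: "subspace class_ring (col_space (X * Q)) V" and s2: "subspace class_ring (col_space X) V"
    unfolding col_space_def using X XQ by (metis cols_dim carrier_matD(1) span_is_subspace)+
  have s: "subspace class_ring (col_space (X * Q)) (vs (col_space X))"
    by (rule nested_subspaces[OF s2 s1 sub])
  have f1: "vectorspace.fin_dim class_ring (vs (col_space (X * Q)))"
    unfolding col_space_def using XQ by (rule fin_dim_span_cols)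
  have f2: "vectorspace.fin_dim class_ring (vs (col_space X))"
    unfolding col_space_def using X by (rule fin_dim_span_cols)
  show ?thesis
    using vectorspace.subspace_dim[OF subspace_is_vs[OF s2] s f2] f1
    unfolding rank_def col_space_def by simp
qed

lemma rank_mult_left:
  assumes X: "X \<in> carrier_mat n n" and P: "P \<in> GL n"
  shows "rank (P * X) = rank X"
proof -
  obtain P' where P': "P' \<in> GL n" "P' * P = 1\<^sub>m n" using GL_inverse[OF P] by metis
  have Pc: "P \<in> carrier_mat n n" and P'c: "P' \<in> carrier_mat n n"
    using P P'(1) by (auto simp: GL_def)
  have PX: "P * X \<in> carrier_mat n n" using X Pc by simp
  have s1: "subspace class_ring (col_space (P * X)) V" and s2: "subspace class_ring (col_space X) V"
    unfolding col_space_def using X PX by (metis cols_dim carrier_matD(1) span_is_subspace)+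
  let ?V = "vs (col_space X)" and ?W = "vs (col_space (P * X))" and ?T = "\<lambda>v. P *\<^sub>v v"
  have f: "vectorspace.fin_dim class_ring ?V"
    unfolding col_space_def using X by (rule fin_dim_span_cols)
  have cX: "col_space X \<subseteq> carrier_vec n" using X by (auto simp: col_space_eq[OF X])
  have img: "?T ` col_space X = col_space (P * X)"
    unfolding col_space_eq[OF PX] col_space_eq[OF X] using X Pc
    by (auto simp: assoc_mult_mat_vec[OF Pc X] image_iff intro!: bexI)
  have inj: "inj_on ?T (col_space X)"
  proof (rule inj_on_inverseI)
    fix v assume "v \<in> col_space X"
    then have "v \<in> carrier_vec n" using cX by auto
    then show "P' *\<^sub>v (P *\<^sub>v v) = v"
      using assoc_mult_mat_vec[OF P'c Pc, of v] P'(2) by simp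
  qed
  have "linear_map class_ring ?V ?W ?T"
  proof -
    have "mod_hom class_ring ?V ?W ?T"
      unfolding mod_hom_def mod_hom_axioms_def module_hom_def
      using subspace_is_vs[OF s1] subspace_is_vs[OF s2] cX img Pc
      by (auto simp: vectorspace_def module_vec_simps mult_add_distrib_mat_vec[OF Pc]
          mult_mat_vec[OF Pc] subset_iff)
    then show ?thesis
      unfolding linear_map_def using subspace_is_vs[OF s1] subspace_is_vs[OF s2] by auto
  qed
  from linear_map.dim_eq[OF this f] inj img show ?thesis
    unfolding rank_def col_space_def by simp
qed

end

lemma rank_GL_mult:
  fixes X :: "'a::field mat"
  assumes X: "X \<in> carrier_mat n n" and P: "P \<in> GL n" and Q: "Q \<in> GL n"
  shows "vec_space.rank n (P * X * Q) = vec_space.rank n X"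
proof -
  obtain Q' where Q': "Q' \<in> GL n" "Q * Q' = 1\<^sub>m n" using GL_inverse[OF Q] by metis
  have c: "P \<in> carrier_mat n n" "Q \<in> carrier_mat n n" "Q' \<in> carrier_mat n n"
    using P Q Q'(1) by (auto simp: GL_def)
  have PX: "P * X \<in> carrier_mat n n" and PXQ: "P * X * Q \<in> carrier_mat n n" using c X by auto
  have "P * X * Q * Q' = P * X"
    using assoc_mult_mat[OF PX c(2) c(3)] Q'(2) right_mult_one_mat[OF PX] by simp
  then have "vec_space.rank n (P * X) \<le> vec_space.rank n (P * X * Q)"
    using vec_space.rank_mult_right[OF PXQ Q'(1)] by simp
  then show ?thesis
    using vec_space.rank_mult_right[OF PX Q] vec_space.rank_mult_left[OF X P] by simp
qed

lemma gcd_connection_set_rank_strata: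
  "gcd_connection_set n (\<Union>k\<in>K. rank_stratum n k)"
  unfolding gcd_connection_set_def
proof (intro equalityI subsetI)
  fix Y :: "'a mat"
  assume "Y \<in> {P * X * Q | P X Q. P \<in> GL n \<and> X \<in> (\<Union>k\<in>K. rank_stratum n k) \<and> Q \<in> GL n}"
  then show "Y \<in> (\<Union>k\<in>K. rank_stratum n k)"
    by (auto simp: rank_stratum_def rank_GL_mult) (auto simp: GL_def)
next
  fix Y :: "'a mat"
  assume Y: "Y \<in> (\<Union>k\<in>K. rank_stratum n k)"
  then have "Y = 1\<^sub>m n * Y * 1\<^sub>m n" by (auto simp: rank_stratum_def)
  with Y one_mat_in_GL
  show "Y \<in> {P * X * Q | P X Q. P \<in> GL n \<and> X \<in> (\<Union>k\<in>K. rank_stratum n k) \<and> Q \<in> GL n}"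
    by blast
qed

lemma finite_carrier_mat: "finite (carrier_mat m n :: 'a::finite mat set)"
proof (rule finite_subset)
  show "carrier_mat m n \<subseteq> (\<lambda>f. mat m n f) ` (({..<m} \<times> {..<n}) \<rightarrow>\<^sub>E (UNIV :: 'a set))"
  proof
    fix A :: "'a mat" assume "A \<in> carrier_mat m n"
    then have "A = mat m n (restrict (\<lambda>ij. A $$ ij) ({..<m} \<times> {..<n}))" by (intro eq_matI) auto
    then show "A \<in> (\<lambda>f. mat m n f) ` (({..<m} \<times> {..<n}) \<rightarrow>\<^sub>E UNIV)"
      by (rule image_eqI[where x = "restrict (\<lambda>ij. A $$ ij) ({..<m} \<times> {..<n})"]) simp
  qed
qed (simp add: finite_PiE)

lemma pair_graph_rank_strata:
  assumes "0 \<notin> K"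
  shows "pair_graph (matrix_cayley_graph n (\<Union>k\<in>K. rank_stratum n k :: 'a::{field,finite} mat set))"
    (is "pair_graph ?G")
proof
  have fin: "finite (carrier_mat n n :: 'a mat set)" by (rule finite_carrier_mat)
  show "finite (pverts ?G)" using fin by (simp add: matrix_cayley_graph_def)
  show "finite (parcs ?G)"
    by (rule finite_subset[OF _ finite_cartesian_product[OF fin fin]])
      (auto simp: matrix_cayley_graph_def)
  show "\<And>e. e \<in> parcs ?G \<Longrightarrow> fst e \<in> pverts ?G" "\<And>e. e \<in> parcs ?G \<Longrightarrow> snd e \<in> pverts ?G"
    by (auto simp: matrix_cayley_graph_def)
  show "fst e \<noteq> snd e" if "e \<in> parcs ?G" for e
  proof
    assume "fst e = snd e"
    with that have "fst e \<in> carrier_mat n n" "vec_space.rank n (fst e - fst e) \<in> K"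
      by (auto simp: matrix_cayley_graph_def rank_stratum_def)
    moreover from this(1) have "fst e - fst e = 0\<^sub>m n n" by (rule minus_r_inv_mat)
    ultimately show False
      using assms vec_space.rank_0I[of n n, where 'a = 'a] by simp
  qed
  show "symmetric ?G"
    unfolding symmetric_def
  proof (rule symI)
    fix X Y assume "(X, Y) \<in> arcs_ends ?G"
    then have c: "X \<in> carrier_mat n n" "Y \<in> carrier_mat n n"
      and k: "vec_space.rank n (X - Y) \<in> K"
      by (auto simp: matrix_cayley_graph_def rank_stratum_def)
    have "- 1\<^sub>m n \<in> (GL n :: 'a mat set)"
      by (auto simp: GL_def invertible_mat_def inverts_mat_def intro!: exI[of _ "- 1\<^sub>m n"])
    moreover have "Y - X = - 1\<^sub>m n * (X - Y) * 1\<^sub>m n"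
    proof -
      have "X - Y \<in> carrier_mat n n" using c by (simp add: minus_carrier_mat)
      then have "- 1\<^sub>m n * (X - Y) * 1\<^sub>m n = - (X - Y)"
        by (metis left_mult_one_mat one_carrier_mat right_mult_one_mat uminus_carrier_iff_mat uminus_mult_left_mat carrier_matD(1) index_one_mat(3))
      also have "\<dots> = Y - X" using c by (intro eq_matI) auto
      finally show ?thesis ..
    qed
    moreover have "X - Y \<in> carrier_mat n n" using c by (simp add: minus_carrier_mat)
    ultimately have "vec_space.rank n (Y - X) = vec_space.rank n (X - Y)"
      using rank_GL_mult[OF _ _ one_mat_in_GL] by metis
    with c k show "(Y, X) \<in> arcs_ends ?G"
      by (auto simp: matrix_cayley_graph_def rank_stratum_def)
  qed
qed

end

theory Submission
  imports Defs
begin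

text \<open>For \<open>n > 1\<close> there is an invertible \<open>C\<close> such that \<open>1 - C\<close> is invertible as well. If \<open>X\<close> has
  rank \<open>k\<^sub>1\<close>, then so do \<open>X C\<close> and \<open>X - X C = X (1 - C)\<close>, so \<open>0\<close>, \<open>X\<close> and \<open>X C\<close> form a triangle.\<close>

text \<open>A singular matrix over a field kills some nonzero vector; otherwise the determinant is a
  unit and an inverse exists. Invertibility of \<open>C\<close> and \<open>1 - C\<close> thus
  becomes a question about linear systems.\<close>

lemma GL_if_kernel_trivial:
  assumes A: "A \<in> carrier_mat n n"
    and kernel: "\<And>v. v \<in> carrier_vec n \<Longrightarrow> A *\<^sub>v v = 0\<^sub>v n \<Longrightarrow> v = 0\<^sub>v n"
  shows "A \<in> GL n"
proof -
  have "det A \<noteq> 0"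
    using kernel det_0_iff_vec_prod_zero_field[OF A] by blast
  from det_non_zero_imp_unit[OF A this, of "()"]
  obtain B where "B \<in> carrier_mat n n" "B * A = 1\<^sub>m n" "A * B = 1\<^sub>m n"
    unfolding Units_def ring_mat_def by auto
  with A show ?thesis
    by (auto simp: GL_def invertible_mat_def inverts_mat_def intro!: exI[of _ B])
qed

text \<open>\<open>C\<close> is the companion matrix of \<open>x\<^sup>n - x + 1\<close>, a polynomial that over every field takes
  the value \<open>1\<close> at both \<open>0\<close> and \<open>1\<close>.\<close>

lemma exists_GL_one_minus_GL:
  assumes n: "n > 1"
  shows "\<exists>C :: 'a::field mat. C \<in> GL n \<and> 1\<^sub>m n - C \<in> GL n"
proof -
  define C :: "'a mat" where
    "C = mat n n (\<lambda>(i, j). if Suc i < n then (if j = Suc i then 1 else 0)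
                            else (if j = 1 then 1 else if j = 0 then -1 else 0))"
  have C: "C \<in> carrier_mat n n" by (simp add: C_def)
  \<comment> \<open>The two row formulas say that \<open>C\<close> shifts the coordinates down by
    one index and puts \<open>v $ 1 - v $ 0\<close> in the last place; index 1 is in range because
    \<open>n > 1\<close>.\<close>
  have row_lt: "(C *\<^sub>v v) $ i = v $ Suc i" if "v \<in> carrier_vec n" "Suc i < n" for v i
  proof -
    have "(C *\<^sub>v v) $ i = (\<Sum>j\<in>{0..<n}. (if j = Suc i then 1 else 0) * v $ j)"
      using that by (simp add: C_def scalar_prod_def)
    also have "\<dots> = (\<Sum>j\<in>{0..<n}. if j = Suc i then v $ j else 0)"
      by (rule sum.cong) auto
    finally show ?thesis using that by simp
  qed
  have row_last: "(C *\<^sub>v v) $ (n - 1) = v $ 1 - v $ 0" if "v \<in> carrier_vec n" for v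
  proof -
    have "(C *\<^sub>v v) $ (n - 1) =
        (\<Sum>j\<in>{0..<n}. (if j = 1 then 1 else if j = 0 then -1 else 0) * v $ j)"
      using that n by (simp add: C_def scalar_prod_def)
    also have "\<dots> = (\<Sum>j\<in>{0..<n}. (if j = 1 then v $ j else 0) - (if j = 0 then v $ j else 0))"
      by (rule sum.cong) auto
    finally show ?thesis using n by (simp add: sum_subtractf)
  qed
  have "C \<in> GL n"
  proof (rule GL_if_kernel_trivial[OF C])
    fix v :: "'a vec" assume v: "v \<in> carrier_vec n" and 0: "C *\<^sub>v v = 0\<^sub>v n"
    \<comment> \<open>The shift rows kill every coordinate except the first, and the last row then
      kills that one.\<close>
    have pos: "v $ Suc i = 0" if "Suc i < n" for i
      using row_lt[OF v that] that by (simp add: 0)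
    have "v $ 0 = 0" using row_last[OF v] pos[of 0] n by (simp add: 0)
    then have "v $ i = 0" if "i < n" for i using pos that by (cases i) auto
    then show "v = 0\<^sub>v n" using v by auto
  qed
  moreover have "1\<^sub>m n - C \<in> GL n"
  proof (rule GL_if_kernel_trivial)
    show "1\<^sub>m n - C \<in> carrier_mat n n" using C by auto
    fix v :: "'a vec" assume v: "v \<in> carrier_vec n" and 0: "(1\<^sub>m n - C) *\<^sub>v v = 0\<^sub>v n"
    have "v - C *\<^sub>v v = 0\<^sub>v n"
      using 0 v C by (simp add: minus_mult_distrib_mat_vec[of _ n n])
    then have fixed: "(C *\<^sub>v v) $ i = v $ i" if "i < n" for i
      using that v C by (metis carrier_matD(1) dim_mult_mat_vec index_minus_vec(1) index_zero_vec(1)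
          right_minus_eq)
    \<comment> \<open>For a fixed vector of \<open>C\<close> the shift rows make all coordinates
      equal, so the last row gives their common value as a difference of equals, which is 0.\<close>
    have const: "v $ i = v $ 0" if "i < n" for i
      using that
    proof (induction i)
      case (Suc i)
      then show ?case using row_lt[OF v, of i] fixed[of i] by simp
    qed simp
    have "v $ (n - 1) = 0" using row_last[OF v] fixed[of "n - 1"] const[of 1] n by simp
    then have "v $ i = 0" if "i < n" for i
      using const[OF that] const[of "n - 1"] n by simp
    then show "v = 0\<^sub>v n" using v by auto
  qed
  ultimately show ?thesis by blast
qed

text \<open>The witness is diagonal: \<open>k\<close> unit columns padded with zero columns. Its
  rank is the size of a maximal independent set of columns.\<close>

lemma (in vec_space) exists_rank:
  assumes k: "k \<le> n"
  shows "\<exists>X \<in> carrier_mat n n. rank X = k"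
proof -
  define S :: "'a vec set" where "S = unit_vec n ` {..<k}"
  define X :: "'a mat" where "X = mat_of_cols n (map (\<lambda>j. if j < k then unit_vec n j else 0\<^sub>v n) [0..<n])"
  have X: "X \<in> carrier_mat n n" by (simp add: X_def mat_of_cols_def)
  have "cols X = map (\<lambda>j. if j < k then unit_vec n j else 0\<^sub>v n) [0..<n]"
    unfolding X_def by (rule cols_mat_of_cols) auto
  then have cols: "S \<subseteq> set (cols X)" "set (cols X) \<subseteq> insert (0\<^sub>v n) S"
    using k by (auto simp: S_def)
  have "S \<subseteq> set (unit_vecs n)" using k by (auto simp: S_def unit_vecs_def)
  then have S: "lin_indpt S"
    using unit_vecs_basis subset_li_is_li unfolding basis_def by blast
  \<comment> \<open>The only column that could enlarge \<open>S\<close> is zero, and no independent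
    set over a nontrivial ring contains it.\<close>
  have "maximal S (\<lambda>T. T \<subseteq> set (cols X) \<and> lin_indpt T)"
    unfolding maximal_def
  proof (intro conjI allI impI)
    fix T assume T: "S \<subseteq> T \<and> T \<subseteq> set (cols X) \<and> lin_indpt T"
    have "T \<subseteq> carrier_vec n" using T cols_dim[of X] X by auto
    moreover have "(UNIV :: 'a set) \<noteq> {0}" using one_neq_zero by blast
    ultimately have "0\<^sub>v n \<notin> T"
      using T zero_nin_lin_indpt[of T] by simp
    then show "T = S" using T cols by blast
  qed (use S cols in auto)
  then have "rank X = card S" by (rule rank_card_indpt[OF X])
  \<comment> \<open>All indices stay below \<open>n\<close>; beyond that,
    \<open>unit_vec n j\<close> would be the zero vector for every \<open>j\<close>.\<close>
  moreover have "inj_on (unit_vec n :: nat \<Rightarrow> 'a vec) {..<k}"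
    using k by (auto simp: inj_on_def)
  then have "card S = k" by (simp add: S_def card_image)
  ultimately show ?thesis using X by blast
qed

theorem theorem3p15:
  fixes n r :: nat
    and k :: "nat \<Rightarrow> nat"
    and S :: "'a::{field, finite} mat set"
  assumes "n > 1"
    and "1 \<le> r" and "r \<le> n - 1"
    and "strict_mono_on {1..r} k"
    and "\<And>i. i \<in> {1..r} \<Longrightarrow> 1 \<le> k i \<and> k i \<le> n"
    and "S = (\<Union>i\<in>{1..r}. rank_stratum n (k i))"
  shows "\<not> bipartite (with_proj (matrix_cayley_graph n S))"
proof
  assume bip: "bipartite (with_proj (matrix_cayley_graph n S))"
  \<comment> \<open>A triangle within a single stratum suffices, and \<open>1 \<le> r\<close> makes
    the index 1 available.\<close>
  have sub: "rank_stratum n (k 1) \<subseteq> S" using assms(2,6) by auto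
  have "k 1 \<le> n" using assms(2,5) by auto
  then obtain X :: "'a mat" where X: "X \<in> carrier_mat n n" and rank: "vec_space.rank n X = k 1"
    using vec_space.exists_rank by blast
  obtain C :: "'a mat" where C: "C \<in> GL n" "1\<^sub>m n - C \<in> GL n"
    using exists_GL_one_minus_GL[OF assms(1)] by blast
  have Cc: "C \<in> carrier_mat n n" using C by (simp add: GL_def)
  have XC: "X * C \<in> carrier_mat n n" using X Cc by simp
  \<comment> \<open>Two-sided invariance of rank, with the identity as left factor.\<close>
  have rank_mult: "vec_space.rank n (X * Q) = k 1" if "Q \<in> GL n" for Q
    using rank_GL_mult[OF X one_mat_in_GL that] X rank by simp
  have "X * (1\<^sub>m n - C) = X - X * C"
    using mult_minus_distrib_mat[OF X one_carrier_mat Cc] right_mult_one_mat[OF X] by simp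
  with rank_mult[OF C(2)] have "vec_space.rank n (X - X * C) = k 1" by simp
  moreover have "X - 0\<^sub>m n n = X" "X * C - 0\<^sub>m n n = X * C"
    using X XC by (auto intro!: eq_matI)
  moreover have "X - X * C \<in> carrier_mat n n" using XC by (rule minus_carrier_mat)
  ultimately have "X - X * C \<in> rank_stratum n (k 1)" "X - 0\<^sub>m n n \<in> rank_stratum n (k 1)"
    "X * C - 0\<^sub>m n n \<in> rank_stratum n (k 1)"
    using rank_mult[OF C(1)] rank X XC unfolding rank_stratum_def by simp_all
  then have "X - X * C \<in> S" "X - 0\<^sub>m n n \<in> S" "X * C - 0\<^sub>m n n \<in> S"
    using sub by blast+
  \<comment> \<open>One orientation per edge is enough, since the bipartition condition is symmetric
    in its two classes.\<close>
  then have arcs: "(X, X * C) \<in> parcs (matrix_cayley_graph n S)"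
    "(X, 0\<^sub>m n n) \<in> parcs (matrix_cayley_graph n S)"
    "(X * C, 0\<^sub>m n n) \<in> parcs (matrix_cayley_graph n S)"
    using X XC by (auto simp: matrix_cayley_graph_def)
  obtain U W where disj: "U \<inter> W = {}" and
    edge: "\<forall>e \<in> parcs (matrix_cayley_graph n S). fst e \<in> U \<and> snd e \<in> W \<or> fst e \<in> W \<and> snd e \<in> U"
    using bip unfolding bipartite_def with_proj_simps by (elim exE conjE)
  \<comment> \<open>Two of the three vertices must share a class, yet every pair is joined by an
    arc.\<close>
  show False
    using disj arcs[THEN edge[THEN bspec]] unfolding fst_conv snd_conv by blast
qed

end
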